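(* Let $\alpha>-\frac12$. The transform $V_{\alpha,q}$ is a linear isomorphism from $\mathcal{E}_q(\mathbb{R}_q)$ onto itself, and its inverse transform is given, for $f\in\mathcal{E}_q(\mathbb{R}_q)$, by $$V_{\alpha,q}^{-1}(f)(x)=R_{\alpha,q}^{-1}(f_e)(x)+\partial_q\big(R_{\alpha,q}^{-1}I_q(f_o)\big)(x)\qquad\text{for all }x\in\mathbb{R}_q,$$ where $R_{\alpha,q}^{-1}$ is the inverse of $R_{\alpha,q}:\mathcal{E}_{*,q}(\mathbb{R}_q)\to\mathcal{E}_{*,q}(\mathbb{R}_q)$ and $I_q(f_o)(x)=\int_0^{|qx|}f_o(t)\,d_qt$.
   Context: Standing assumptions: $q\in(0,1)$ and $\frac{\log(1-q)}{\log q}\in 2\mathbb{Z}$. Functions are complex-valued. $\mathbb{R}_q=\{\pm q^n: n\in\mathbb{Z}\}$; $f_e,f_o$ are the even and odd parts of $f$. Notation: $(a;q)_\infty=\prod_{k\ge0}(1-aq^k)$, $\Gamma_{q^2}(x)=\frac{(q^2;q^2)_\infty}{(q^{2x};q^2)_\infty}(1-q^2)^{1-x}$. $q$-Jackson integrals: $\int_0^af(x)d_qx=(1-q)a\sum_{n\ge0}q^nf(aq^n)$, $\int_{-1}^1h(t)d_qt=(1-q)\sum_{n\ge0}q^n[h(q^n)+h(-q^n)]$. For $z\neq0$, $\partial_q f(z)=\frac{f(q^{-1}z)+f(-q^{-1}z)-f(qz)+f(-qz)-2f(-z)}{2(1-q)z}$. $\mathcal{E}_q(\mathbb{R}_q)$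 is the space of functions $f$ on $\mathbb{R}_q$ such that for all $n\in\mathbb{N}$, $a\ge0$, $\sup\{|\partial_q^kf(x)|:0\le k\le n,\ x\in[-a,a]\cap\mathbb{R}_q\}<\infty$ and $\lim_{x\to0,x\in\mathbb{R}_q}\partial_q^nf(x)$ exists. $\mathcal{E}_{*,q}(\mathbb{R}_q)$ is its subspace of even functions. $C(\alpha;q^2)=(1+q)\frac{\Gamma_{q^2}(\alpha+1)}{\Gamma_{q^2}(\frac12)\Gamma_{q^2}(\alpha+\frac12)}$, $W_\alpha(t;q^2)=\frac{(t^2q^2;q^2)_\infty}{(t^2q^{2\alpha+1};q^2)_\infty}$. $q$-Dunkl intertwining operator: for $f\in\mathcal{E}_q(\mathbb{R}_q)$, $V_{\alpha,q}(f)(x)=\frac{C(\alpha;q^2)}{2}\int_{-1}^1W_\alpha(t;q^2)(1+t)f(xt)d_qt$. $q$-Riemann–Liouville operator: for $f\in\mathcal{E}_{*,q}(\mathbb{R}_q)$, $R_{\alpha,q}(f)(x)=\frac{C(\alpha;q^2)}{2}\int_{-1}^1W_\alpha(t;q^2)f(xt)d_qt$. It is known that $R_{\alpha,q}$ is a bijection (indeed a topological isomorphism) from $\mathcal{E}_{*,q}(\mathbb{R}_q)$ onto itself, so $R_{\alpha,q}^{-1}$ makes sense. *)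

theory Defs
  imports "HOL-Analysis.Analysis" "HOL-Library.Function_Algebras"
begin

definition qpoch_inf :: "real \<Rightarrow> real \<Rightarrow> real" where
  "qpoch_inf a q = (\<Prod>k. 1 - a * q ^ k)"

text \<open>The \<open>q\<close>-Gamma function with its base as first argument; it is used below with base \<open>q\<^sup>2\<close>,
  where \<open>(q\<^sup>2) powr x\<close> is \<open>q\<^bsup>2x\<^esup>\<close>.\<close>

definition qGamma :: "real \<Rightarrow> real \<Rightarrow> real" where
  "qGamma p x = qpoch_inf p p / qpoch_inf (p powr x) p * (1 - p) powr (1 - x)"

definition Rq :: "real \<Rightarrow> real set" where
  "Rq q = {x. \<exists>n::int. x = q powi n \<or> x = - (q powi n)}"

definition jackson :: "real \<Rightarrow> real \<Rightarrow> (real \<Rightarrow> complex) \<Rightarrow> complex" where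
  "jackson q a f = of_real ((1 - q) * a) * (\<Sum>n. of_real (q ^ n) * f (a * q ^ n))"

definition jackson_sym :: "real \<Rightarrow> (real \<Rightarrow> complex) \<Rightarrow> complex" where
  "jackson_sym q h = of_real (1 - q) * (\<Sum>n. of_real (q ^ n) * (h (q ^ n) + h (- (q ^ n))))"

definition qderiv :: "real \<Rightarrow> (real \<Rightarrow> complex) \<Rightarrow> real \<Rightarrow> complex" where
  "qderiv q f z =
     (f (inverse q * z) + f (- (inverse q * z)) - f (q * z) + f (- (q * z)) - 2 * f (- z))
       / of_real (2 * (1 - q) * z)"

text \<open>A function on \<open>Rq q\<close> is represented by its extension by zero to the real line (in particular,
  the value at \<open>0\<close> is always \<open>0\<close>, and does not stand for the limit there). Since \<open>Rq q\<close> is closed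
  under negation and under multiplication by powers of \<open>q\<close>, and excludes \<open>0\<close>, all operators below
  only use the values at points of \<open>Rq q\<close> when evaluated at such a point, and map functions
  vanishing off \<open>Rq q\<close> to functions vanishing off \<open>Rq q\<close>.\<close>

definition Eq :: "real \<Rightarrow> (real \<Rightarrow> complex) set" where
  "Eq q = {f. (\<forall>x. x \<notin> Rq q \<longrightarrow> f x = 0) \<and>
     (\<forall>(n::nat) (a::real). a \<ge> 0 \<longrightarrow>
        bdd_above {cmod ((qderiv q ^^ k) f x) | k x. k \<le> n \<and> x \<in> {-a..a} \<inter> Rq q}) \<and>
     (\<forall>n::nat. \<exists>L. ((qderiv q ^^ n) f \<longlongrightarrow> L) (at 0 within Rq q))}"

definition Eq_even :: "real \<Rightarrow> (real \<Rightarrow> complex) set" where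
  "Eq_even q = {f \<in> Eq q. \<forall>x. f (- x) = f x}"

definition even_part :: "(real \<Rightarrow> complex) \<Rightarrow> real \<Rightarrow> complex" where
  "even_part f x = (f x + f (- x)) / 2"

definition odd_part :: "(real \<Rightarrow> complex) \<Rightarrow> real \<Rightarrow> complex" where
  "odd_part f x = (f x - f (- x)) / 2"

definition Cq :: "real \<Rightarrow> real \<Rightarrow> real" where
  "Cq q \<alpha> = (1 + q) * qGamma (q\<^sup>2) (\<alpha> + 1) / (qGamma (q\<^sup>2) (1 / 2) * qGamma (q\<^sup>2) (\<alpha> + 1 / 2))"

definition Wq :: "real \<Rightarrow> real \<Rightarrow> real \<Rightarrow> real" where
  "Wq q \<alpha> t = qpoch_inf (t\<^sup>2 * q\<^sup>2) (q\<^sup>2) / qpoch_inf (t\<^sup>2 * q powr (2 * \<alpha> + 1)) (q\<^sup>2)"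

definition Vop :: "real \<Rightarrow> real \<Rightarrow> (real \<Rightarrow> complex) \<Rightarrow> real \<Rightarrow> complex" where
  "Vop q \<alpha> f x =
     of_real (Cq q \<alpha> / 2) * jackson_sym q (\<lambda>t. of_real (Wq q \<alpha> t * (1 + t)) * f (x * t))"

definition Rop :: "real \<Rightarrow> real \<Rightarrow> (real \<Rightarrow> complex) \<Rightarrow> real \<Rightarrow> complex" where
  "Rop q \<alpha> f x =
     of_real (Cq q \<alpha> / 2) * jackson_sym q (\<lambda>t. of_real (Wq q \<alpha> t) * f (x * t))"

definition Iq :: "real \<Rightarrow> (real \<Rightarrow> complex) \<Rightarrow> real \<Rightarrow> complex" where
  "Iq q f x = jackson q \<bar>q * x\<bar> f"

definition cscale :: "complex \<Rightarrow> ('a \<Rightarrow> complex) \<Rightarrow> 'a \<Rightarrow> complex" where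
  "cscale c f = (\<lambda>x. c * f x)"

global_interpretation cfun: vector_space "cscale :: complex \<Rightarrow> ('a \<Rightarrow> complex) \<Rightarrow> 'a \<Rightarrow> complex"
  by unfold_locales (auto simp: cscale_def fun_eq_iff algebra_simps)

definition linear_iso_on ::
    "('a \<Rightarrow> complex) set \<Rightarrow> ('b \<Rightarrow> complex) set \<Rightarrow> (('a \<Rightarrow> complex) \<Rightarrow> ('b \<Rightarrow> complex)) \<Rightarrow> bool" where
  "linear_iso_on S T F \<longleftrightarrow>
     cfun.subspace S \<and> cfun.subspace T \<and>
     (\<forall>f\<in>S. \<forall>g\<in>S. F (f + g) = F f + F g) \<and>
     (\<forall>c. \<forall>f\<in>S. F (cscale c f) = cscale c (F f)) \<and>
     bij_betw F S T"

end

(* On the lattice Rq both operators are power series in the dilation f |-> f(q.): the operator R acts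
   on even functions as the sum of a_n f(q^n x), and V acts in the same way on even functions, while
   on odd functions its coefficients are q^n a_n. By the q-binomial theorem the generating function of (a_n)
   is, up to a constant, (q A z; q^2)_inf / (q z; q^2)_inf with A = q^(2 alpha + 1) < 1. Its reciprocal
   has radius of convergence 1/(q A) > 1, so its coefficients b_n are absolutely summable and yield the
   inverse series. Since the q-derivative picks up a factor q^n from the n-th dilation,
   absolutely summable series preserve Eq, and, since the q-derivative of I_q f is f for odd f,
   the odd part of the inverse, with coefficients q^n b_n, is the q-derivative of R^{-1} I_q. *)

theory Submission
  imports Defs
begin

text \<open>At the nodes \<open>q ^ n\<close> a Jackson integral becomes a power series in the
  dilation \<open>f(x) -> f(q x)\<close>. Composing two such series amounts to multiplying their
  coefficient sequences as formal power series.\<close>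

definition dilsum :: "real \<Rightarrow> (nat \<Rightarrow> real) \<Rightarrow> (real \<Rightarrow> complex) \<Rightarrow> real \<Rightarrow> complex" where
  "dilsum q c f x = (\<Sum>n. of_real (c n) * f (x * q ^ n))"

section \<open>The space of smooth functions\<close>

lemma Rq_nonzero: "0 < q \<Longrightarrow> x \<in> Rq q \<Longrightarrow> x \<noteq> 0"
  by (auto simp: Rq_def)

lemma Rq_minus_iff [simp]: "- x \<in> Rq q \<longleftrightarrow> x \<in> Rq q"
  unfolding Rq_def by simp (metis minus_equation_iff)

lemma Rq_mult:
  assumes "0 < q" "x \<in> Rq q" "y \<in> Rq q"
  shows "x * y \<in> Rq q"
proof -
  obtain m n :: int where "x = q powi m \<or> x = - (q powi m)" "y = q powi n \<or> y = - (q powi n)"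
    using assms unfolding Rq_def by blast
  then have "x * y = q powi (m + n) \<or> x * y = - (q powi (m + n))"
    using assms(1) by (auto simp: power_int_add)
  then show ?thesis unfolding Rq_def by blast
qed

lemma Rq_power: "q ^ n \<in> Rq q" and Rq_inverse_power: "inverse (q ^ n) \<in> Rq q"
proof -
  have "q ^ n = q powi int n" "inverse (q ^ n) = q powi (- int n)"
    by (simp_all add: power_int_minus)
  then show "q ^ n \<in> Rq q" "inverse (q ^ n) \<in> Rq q" unfolding Rq_def by blast+
qed

lemma Rq_mult_power_iff:
  assumes "0 < q"
  shows "x * q ^ n \<in> Rq q \<longleftrightarrow> x \<in> Rq q"
proof
  assume "x * q ^ n \<in> Rq q"
  then have "x * q ^ n * inverse (q ^ n) \<in> Rq q"
    using Rq_mult[OF assms] Rq_inverse_power by blast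
  then show "x \<in> Rq q" using assms by (simp add: mult.assoc)
qed (use Rq_mult[OF assms] Rq_power in blast)

lemma Rq_q_mult_iff:
  assumes "0 < q"
  shows "q * x \<in> Rq q \<longleftrightarrow> x \<in> Rq q" and "inverse q * x \<in> Rq q \<longleftrightarrow> x \<in> Rq q"
  using Rq_mult_power_iff[OF assms, of x 1] Rq_mult_power_iff[OF assms, of "inverse q * x" 1] assms
  by (simp_all add: mult.commute[of x] mult.commute[of "inverse q * x"] flip: mult.assoc)

section \<open>q-derivatives and closure properties of \<open>Eq q\<close>\<close>

lemma qderiv_eq_0_off_Rq:
  assumes "0 < q" and f: "\<And>x. x \<notin> Rq q \<Longrightarrow> f x = 0" and x: "x \<notin> Rq q"
  shows "qderiv q f x = 0"
proof -
  have "f (q * x) = 0" "f (- (q * x)) = 0" "f (inverse q * x) = 0" "f (- (inverse q * x)) = 0"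
    "f (- x) = 0"
    using x Rq_q_mult_iff[OF assms(1), of x] by (auto intro!: f simp del: minus_mult_left minus_mult_right)
  then show ?thesis unfolding qderiv_def by simp
qed

lemma qderiv_pow_eq_0_off_Rq:
  assumes "0 < q" and "\<And>x. x \<notin> Rq q \<Longrightarrow> f x = 0"
  shows "x \<notin> Rq q \<Longrightarrow> (qderiv q ^^ k) f x = 0"
  using assms by (induction k arbitrary: x) (auto intro: qderiv_eq_0_off_Rq)

text \<open>All q-derivatives vanish off the lattice, so bounds may range over the whole interval. A
  bound for all orders up to \<open>n\<close> is the maximum of finitely many bounds, one per
  order.\<close>

lemma Eq_iff:
  assumes "0 < q"
  shows "f \<in> Eq q \<longleftrightarrow> (\<forall>x. x \<notin> Rq q \<longrightarrow> f x = 0) \<and>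
     (\<forall>k a. \<exists>M. \<forall>x. \<bar>x\<bar> \<le> a \<longrightarrow> cmod ((qderiv q ^^ k) f x) \<le> M) \<and>
     (\<forall>k. \<exists>L. ((qderiv q ^^ k) f \<longlongrightarrow> L) (at 0 within Rq q))"
    (is "_ \<longleftrightarrow> ?off \<and> ?bdd \<and> ?lim")
proof -
  have "(\<forall>(n::nat) (a::real). a \<ge> 0 \<longrightarrow>
        bdd_above {cmod ((qderiv q ^^ k) f x) | k x. k \<le> n \<and> x \<in> {-a..a} \<inter> Rq q}) \<longleftrightarrow> ?bdd"
    (is "?L \<longleftrightarrow> _") if off: ?off
  proof
    assume L: ?L
    show ?bdd
    proof (intro allI)
      fix k :: nat and a :: real
      have "bdd_above {cmod ((qderiv q ^^ j) f x) | j x. j \<le> k \<and> x \<in> {-\<bar>a\<bar>..\<bar>a\<bar>} \<inter> Rq q}"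
        using L by simp
      then obtain M where M:
        "\<And>y. y \<in> {cmod ((qderiv q ^^ j) f x) | j x. j \<le> k \<and> x \<in> {-\<bar>a\<bar>..\<bar>a\<bar>} \<inter> Rq q} \<Longrightarrow> y \<le> M"
        unfolding bdd_above_def by blast
      \<comment> \<open>\<open>M\<close> can be negative when the interval misses
        \<open>Rq q\<close>, as for \<open>a = 0\<close>; the maximum with 0 also covers the points
        off the lattice, where the derivative is 0.\<close>
      have "cmod ((qderiv q ^^ k) f x) \<le> max M 0" if "\<bar>x\<bar> \<le> a" for x
      proof (cases "x \<in> Rq q")
        case True
        then have "cmod ((qderiv q ^^ k) f x) \<le> M" using that by (intro M) fastforce
        then show ?thesis by simp
      next
        case False
        then have "(qderiv q ^^ k) f x = 0"
          using off by (intro qderiv_pow_eq_0_off_Rq[OF assms]) auto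
        then show ?thesis by simp
      qed
      then show "\<exists>M. \<forall>x. \<bar>x\<bar> \<le> a \<longrightarrow> cmod ((qderiv q ^^ k) f x) \<le> M" by blast
    qed
  next
    assume ?bdd
    then obtain M where M: "\<And>k a x. \<bar>x\<bar> \<le> a \<Longrightarrow> cmod ((qderiv q ^^ k) f x) \<le> M k a" by metis
    show ?L
    proof (intro allI impI)
      fix n :: nat and a :: real
      have "y \<le> Max ((\<lambda>k. M k a) ` {..n})"
        if y: "y \<in> {cmod ((qderiv q ^^ k) f x) | k x. k \<le> n \<and> x \<in> {-a..a} \<inter> Rq q}" for y
      proof -
        obtain k x where "y = cmod ((qderiv q ^^ k) f x)" "k \<le> n" "\<bar>x\<bar> \<le> a"
          using y by (auto simp: abs_le_iff)
        then have "y \<le> M k a" "M k a \<le> Max ((\<lambda>k. M k a) ` {..n})" using M by auto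
        then show ?thesis by linarith
      qed
      then show "bdd_above {cmod ((qderiv q ^^ k) f x) | k x. k \<le> n \<and> x \<in> {-a..a} \<inter> Rq q}"
        by (rule bdd_aboveI)
    qed
  qed
  then show ?thesis unfolding Eq_def by auto
qed

lemma Eq_off: "f \<in> Eq q \<Longrightarrow> x \<notin> Rq q \<Longrightarrow> f x = 0"
  by (simp add: Eq_def)

lemma Eq_bound:
  assumes "0 < q" "f \<in> Eq q"
  obtains M where "M \<ge> 0" "\<And>x. \<bar>x\<bar> \<le> a \<Longrightarrow> cmod ((qderiv q ^^ k) f x) \<le> M"
proof -
  obtain M where "\<forall>x. \<bar>x\<bar> \<le> a \<longrightarrow> cmod ((qderiv q ^^ k) f x) \<le> M"
    using assms unfolding Eq_iff[OF assms(1)] by blast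
  then have "\<And>x. \<bar>x\<bar> \<le> a \<Longrightarrow> cmod ((qderiv q ^^ k) f x) \<le> max M 0" by (meson max.coboundedI1)
  then show ?thesis using that[of "max M 0"] by simp
qed

lemma Eq_tendsto:
  assumes "f \<in> Eq q"
  obtains L where "((qderiv q ^^ k) f \<longlongrightarrow> L) (at 0 within Rq q)"
  using assms unfolding Eq_def by blast

text \<open>Chain rule: only the denominator of \<open>qderiv\<close> sees the scaling, and each
  derivative contributes one factor \<open>c\<close>. For a zero denominator both sides are 0. The
  case \<open>c = -1\<close> serves for reflections.\<close>

lemma qderiv_pow_dilate:
  assumes "c \<noteq> 0"
  shows "(qderiv q ^^ k) (\<lambda>x. f (c * x)) = (\<lambda>x. of_real (c ^ k) * (qderiv q ^^ k) f (c * x))"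
proof (induction k)
  case (Suc k)
  have *: "qderiv q (\<lambda>x. d * g (c * x)) z = d * of_real c * qderiv q g (c * z)" for d g z
    using assms by (cases "z = 0"; cases "q = 1") (simp_all add: qderiv_def field_simps)
  show ?case by (rule ext) (simp add: Suc.IH *)
qed simp

lemma qderiv_pow_add:
  "(qderiv q ^^ k) (\<lambda>x. f x + g x) = (\<lambda>x. (qderiv q ^^ k) f x + (qderiv q ^^ k) g x)"
  by (induction k) (auto simp: qderiv_def fun_eq_iff add_divide_distrib[symmetric] algebra_simps)

lemma qderiv_pow_mult:
  "(qderiv q ^^ k) (\<lambda>x. c * f x) = (\<lambda>x. c * (qderiv q ^^ k) f x)"
  by (induction k) (auto simp: qderiv_def fun_eq_iff algebra_simps diff_divide_distrib add_divide_distrib)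

lemma Eq_add:
  assumes q: "0 < q" and f: "f \<in> Eq q" and g: "g \<in> Eq q"
  shows "(\<lambda>x. f x + g x) \<in> Eq q"
proof -
  have "\<exists>M. \<forall>x. \<bar>x\<bar> \<le> a \<longrightarrow> cmod ((qderiv q ^^ k) f x + (qderiv q ^^ k) g x) \<le> M" for k a
  proof -
    obtain M N where "\<And>x. \<bar>x\<bar> \<le> a \<Longrightarrow> cmod ((qderiv q ^^ k) f x) \<le> M"
      "\<And>x. \<bar>x\<bar> \<le> a \<Longrightarrow> cmod ((qderiv q ^^ k) g x) \<le> N"
      using Eq_bound[OF q f, of a k] Eq_bound[OF q g, of a k] by metis
    then show ?thesis by (intro exI[of _ "M + N"]) (meson add_mono norm_triangle_ineq order_trans)
  qed
  moreover have "\<exists>L. ((\<lambda>x. (qderiv q ^^ k) f x + (qderiv q ^^ k) g x) \<longlongrightarrow> L) (at 0 within Rq q)" for k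
    using Eq_tendsto[OF f, of k] Eq_tendsto[OF g, of k] by (metis tendsto_add)
  ultimately show ?thesis
    using f g by (simp add: Eq_iff[OF q] qderiv_pow_add)
qed

lemma Eq_mult:
  assumes q: "0 < q" and f: "f \<in> Eq q"
  shows "(\<lambda>x. c * f x) \<in> Eq q"
proof -
  have "\<exists>M. \<forall>x. \<bar>x\<bar> \<le> a \<longrightarrow> cmod (c * (qderiv q ^^ k) f x) \<le> M" for k a
  proof -
    obtain M where "\<And>x. \<bar>x\<bar> \<le> a \<Longrightarrow> cmod ((qderiv q ^^ k) f x) \<le> M"
      using Eq_bound[OF q f, of a k] by metis
    then show ?thesis
      by (intro exI[of _ "cmod c * M"]) (simp add: norm_mult mult_left_mono)
  qed
  moreover have "\<exists>L. ((\<lambda>x. c * (qderiv q ^^ k) f x) \<longlongrightarrow> L) (at 0 within Rq q)" for k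
    using Eq_tendsto[OF f, of k] by (metis tendsto_mult_left)
  ultimately show ?thesis
    using f by (simp add: Eq_iff[OF q] qderiv_pow_mult)
qed

text \<open>Scaling by a lattice point keeps the argument in \<open>Rq q\<close> and away from 0, so
  limits at 0 along the lattice survive dilation and reflection.\<close>

lemma filterlim_scale_at_0_within_Rq:
  assumes "0 < q" "c \<in> Rq q"
  shows "filterlim (\<lambda>x. c * x) (at 0 within Rq q) (at 0 within Rq q)"
proof -
  have "((\<lambda>x. c * x) \<longlongrightarrow> c * 0) (at 0 within Rq q)" by (intro tendsto_intros)
  moreover have "eventually (\<lambda>x. c * x \<in> Rq q \<and> c * x \<noteq> 0) (at 0 within Rq q)"
    unfolding eventually_at_filter
    using Rq_mult[OF assms] Rq_nonzero[OF assms(1)] assms(2) by (metis (mono_tags, lifting) always_eventually)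
  ultimately show ?thesis by (simp add: filterlim_at)
qed

lemma Eq_reflect:
  assumes q: "0 < q" and f: "f \<in> Eq q"
  shows "(\<lambda>x. f (- x)) \<in> Eq q"
proof -
  have D: "(qderiv q ^^ k) (\<lambda>x. f (- x)) = (\<lambda>x. of_real ((-1) ^ k) * (qderiv q ^^ k) f (- x))" for k
    using qderiv_pow_dilate[where c = "-1" and f = f] by simp
  have "\<exists>M. \<forall>x. \<bar>x\<bar> \<le> a \<longrightarrow> cmod ((qderiv q ^^ k) (\<lambda>x. f (- x)) x) \<le> M" for k a
  proof -
    obtain M where "\<And>x. \<bar>x\<bar> \<le> a \<Longrightarrow> cmod ((qderiv q ^^ k) f x) \<le> M"
      using Eq_bound[OF q f, of a k] by metis
    then show ?thesis by (intro exI[of _ M]) (simp add: D norm_mult norm_power)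
  qed
  moreover have "\<exists>L. ((qderiv q ^^ k) (\<lambda>x. f (- x)) \<longlongrightarrow> L) (at 0 within Rq q)" for k
  proof -
    obtain L where L: "((qderiv q ^^ k) f \<longlongrightarrow> L) (at 0 within Rq q)"
      using Eq_tendsto[OF f] by blast
    have "-1 \<in> Rq q" using Rq_power[of q 0] Rq_minus_iff[of 1 q] by simp
    then have "((\<lambda>x. (qderiv q ^^ k) f (- x)) \<longlongrightarrow> L) (at 0 within Rq q)"
      using filterlim_compose[OF L filterlim_scale_at_0_within_Rq[OF q, of "-1"]] by simp
    from tendsto_mult_left[OF this] show ?thesis unfolding D by blast
  qed
  ultimately show ?thesis
    using f by (simp add: Eq_iff[OF q])
qed

lemma even_part_Eq_even: "0 < q \<Longrightarrow> f \<in> Eq q \<Longrightarrow> even_part f \<in> Eq_even q"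
  using Eq_mult[of q "\<lambda>x. f x + f (- x)" "1/2"] Eq_add[OF _ _ Eq_reflect, of q f f]
  by (simp add: even_part_def[abs_def] Eq_even_def add.commute)

lemma odd_part_Eq: "0 < q \<Longrightarrow> f \<in> Eq q \<Longrightarrow> odd_part f \<in> Eq q"
  using Eq_mult[of q "\<lambda>x. f x + (- 1) * f (- x)" "1/2"]
    Eq_add[OF _ _ Eq_mult[OF _ Eq_reflect], of q f f "-1"]
  by (simp add: odd_part_def[abs_def])

lemma subspace_Eq:
  assumes "0 < q"
  shows "cfun.subspace (Eq q)"
proof (rule cfun.subspaceI)
  have "(qderiv q ^^ k) (\<lambda>x. 0) = (\<lambda>x. 0)" for k
    using qderiv_pow_mult[of k q 0 "\<lambda>x. 0"] by simp
  then show "0 \<in> Eq q"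
    by (auto simp: Eq_iff[OF assms] zero_fun_def)
qed (use Eq_add[OF assms] Eq_mult[OF assms] in \<open>auto simp: cscale_def plus_fun_def\<close>)

section \<open>Series of dilations\<close>

lemma abs_dilate_le:
  fixes x :: real
  assumes "0 < q" "q < 1"
  shows "\<bar>x * q ^ n\<bar> \<le> \<bar>x\<bar>"
  using assms mult_left_mono[of "q ^ n" 1 "\<bar>x\<bar>"] by (simp add: abs_mult power_le_one)

text \<open>All points \<open>x * q ^ n\<close> stay within distance \<bar>x\<bar> of 0, so a single
  bound \<open>M\<close> dominates the series by \<open>M\<close> times the summable
  coefficients.\<close>

lemma dilate_summable:
  fixes q :: real and c :: "nat \<Rightarrow> real"
  assumes "0 < q" "q < 1" "summable (\<lambda>n. \<bar>c n\<bar>)" and f: "\<And>y. \<bar>y\<bar> \<le> \<bar>x\<bar> \<Longrightarrow> cmod (f y) \<le> M"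
  shows "summable (\<lambda>n. cmod (of_real (c n) * f (x * q ^ n)))"
proof (rule summable_comparison_test')
  show "summable (\<lambda>n. \<bar>c n\<bar> * M)" by (intro summable_mult2 assms)
  fix n
  have "\<bar>x * q ^ n\<bar> \<le> \<bar>x\<bar>"
    by (rule abs_dilate_le[OF assms(1,2)])
  then show "norm (cmod (of_real (c n) * f (x * q ^ n))) \<le> \<bar>c n\<bar> * M"
    using f by (simp add: norm_mult mult_left_mono)
qed

lemma Eq_dilate_summable:
  assumes "0 < q" "q < 1" "summable (\<lambda>n. \<bar>c n\<bar>)" and "f \<in> Eq q"
  shows "summable (\<lambda>n. cmod (of_real (c n) * (qderiv q ^^ k) f (x * q ^ n)))"
proof -
  obtain M where "\<And>y. \<bar>y\<bar> \<le> \<bar>x\<bar> \<Longrightarrow> cmod ((qderiv q ^^ k) f y) \<le> M"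
    using Eq_bound[OF assms(1,4)] by metis
  then show ?thesis by (rule dilate_summable[OF assms(1-3)])
qed

lemma summable_abs_mult_power:
  fixes c :: "nat \<Rightarrow> real"
  assumes "0 < q" "q < 1" "summable (\<lambda>n. \<bar>c n\<bar>)"
  shows "summable (\<lambda>n. \<bar>c n * q ^ (n * k)\<bar>)"
proof (rule summable_comparison_test'[OF assms(3)])
  fix n
  have "q ^ (n * k) \<le> 1" using assms by (simp add: power_le_one)
  then show "norm \<bar>c n * q ^ (n * k)\<bar> \<le> \<bar>c n\<bar>"
    using assms(1) by (simp add: abs_mult mult_left_le)
qed

text \<open>The q-derivative is a finite combination of values, so pointwise convergence suffices to
  apply it term by term. At \<open>x = 0\<close> both sides are 0 by division by zero.\<close>

lemma qderiv_dilsum: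
  assumes "q < 1" and f: "\<And>x. summable (\<lambda>n. of_real (c n) * f (x * q ^ n))"
    and q0: "0 < q"
  shows "qderiv q (dilsum q c f) x = dilsum q (\<lambda>n. c n * q ^ n) (qderiv q f) x"
proof (cases "x = 0")
  case True
  then show ?thesis by (simp add: qderiv_def dilsum_def)
next
  case False
  have s: "(\<lambda>n. of_real (c n) * f (y * q ^ n)) sums dilsum q c f y" for y
    unfolding dilsum_def using f by (rule summable_sums)
  have "(\<lambda>n. (of_real (c n) * f (inverse q * x * q ^ n) + of_real (c n) * f (- (inverse q * x) * q ^ n)
       - of_real (c n) * f (q * x * q ^ n) + of_real (c n) * f (- (q * x) * q ^ n)
       - 2 * (of_real (c n) * f (- x * q ^ n))) / of_real (2 * (1 - q) * x)) sums qderiv q (dilsum q c f) x"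
    unfolding qderiv_def by (intro sums_divide sums_add sums_diff sums_mult s)
  moreover have "(of_real (c n) * f (inverse q * x * q ^ n) + of_real (c n) * f (- (inverse q * x) * q ^ n)
       - of_real (c n) * f (q * x * q ^ n) + of_real (c n) * f (- (q * x) * q ^ n)
       - 2 * (of_real (c n) * f (- x * q ^ n))) / of_real (2 * (1 - q) * x)
     = of_real (c n * q ^ n) * qderiv q f (x * q ^ n)" for n
  proof -
    \<comment> \<open>The denominator at \<open>x * q ^ n\<close> carries an additional
      \<open>q ^ n\<close>, which cancels the one in the new coefficient.\<close>
    have cancel: "of_real (c n * q ^ n) * (S / of_real (2 * (1 - q) * (x * q ^ n)))
        = of_real (c n) * S / of_real (2 * (1 - q) * x)" for S :: complex
      using assms(1) q0 False by (simp add: field_simps)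
    show ?thesis unfolding qderiv_def cancel by (simp add: algebra_simps)
  qed
  ultimately have "(\<lambda>n. of_real (c n * q ^ n) * qderiv q f (x * q ^ n)) sums qderiv q (dilsum q c f) x"
    by simp
  then show ?thesis by (simp add: dilsum_def sums_unique)
qed

lemma qderiv_pow_dilsum:
  assumes "0 < q" "q < 1" "summable (\<lambda>n. \<bar>c n\<bar>)" and "f \<in> Eq q"
  shows "(qderiv q ^^ k) (dilsum q c f) = dilsum q (\<lambda>n. c n * q ^ (n * k)) ((qderiv q ^^ k) f)"
proof (induction k)
  case (Suc k)
  have "qderiv q (dilsum q (\<lambda>n. c n * q ^ (n * k)) ((qderiv q ^^ k) f)) x
      = dilsum q (\<lambda>n. c n * q ^ (n * k) * q ^ n) (qderiv q ((qderiv q ^^ k) f)) x" for x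
    by (rule qderiv_dilsum[OF assms(2) summable_norm_cancel assms(1)])
      (rule Eq_dilate_summable[OF assms(1,2) summable_abs_mult_power[OF assms(1-3)] assms(4)])
  then show ?case by (simp add: Suc.IH fun_eq_iff power_add mult_ac)
qed simp

text \<open>Each q-derivative of the series is again a dilation series, applied to a derivative of
  \<open>f\<close>, with absolutely summable coefficients. Domination by these coefficients gives
  the bounds, and Tannery's theorem the limit at 0.\<close>

lemma dilsum_Eq:
  assumes q: "0 < q" "q < 1" and c: "summable (\<lambda>n. \<bar>c n\<bar>)" and f: "f \<in> Eq q"
  shows "dilsum q c f \<in> Eq q"
proof -
  let ?D = "\<lambda>k. (qderiv q ^^ k) f"
  note contr = abs_dilate_le[OF q]
  \<comment> \<open>This \<open>c\<close> is a fresh variable: the claims are later used for the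
    coefficients \<open>c n * q ^ (n * k)\<close> of the \<open>k\<close>-th derivative.\<close>
  have bd: "\<exists>M. \<forall>x. \<bar>x\<bar> \<le> a \<longrightarrow> cmod (dilsum q c (?D k) x) \<le> M"
    and lim: "\<exists>L. (dilsum q c (?D k) \<longlongrightarrow> L) (at 0 within Rq q)"
    if c: "summable (\<lambda>n. \<bar>c n\<bar>)" for k a and c :: "nat \<Rightarrow> real"
  proof -
    obtain M where M: "\<And>x. \<bar>x\<bar> \<le> a \<Longrightarrow> cmod (?D k x) \<le> M"
      using Eq_bound[OF q(1) f] by metis
    have "cmod (dilsum q c (?D k) x) \<le> (\<Sum>n. \<bar>c n\<bar> * M)" if "\<bar>x\<bar> \<le> a" for x
    proof -
      have s: "summable (\<lambda>n. cmod (of_real (c n) * ?D k (x * q ^ n)))"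
        by (rule Eq_dilate_summable[OF q c f])
      have "cmod (dilsum q c (?D k) x) \<le> (\<Sum>n. cmod (of_real (c n) * ?D k (x * q ^ n)))"
        unfolding dilsum_def by (rule summable_norm[OF s])
      also have "\<dots> \<le> (\<Sum>n. \<bar>c n\<bar> * M)"
        using contr that
        by (intro suminf_le s summable_mult2 c)
          (auto simp: norm_mult intro!: mult_left_mono M intro: order_trans)
      finally show ?thesis .
    qed
    then show "\<exists>M. \<forall>x. \<bar>x\<bar> \<le> a \<longrightarrow> cmod (dilsum q c (?D k) x) \<le> M" by blast
    obtain L where L: "(?D k \<longlongrightarrow> L) (at 0 within Rq q)" using Eq_tendsto[OF f] by blast
    obtain N where N: "N \<ge> 0" "\<And>x. \<bar>x\<bar> \<le> 1 \<Longrightarrow> cmod (?D k x) \<le> N"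
      using Eq_bound[OF q(1) f] by metis
    show "\<exists>L. (dilsum q c (?D k) \<longlongrightarrow> L) (at 0 within Rq q)"
    \<comment> \<open>Tannery's theorem asks for a nontrivial filter. For the trivial filter every
      limit holds, so no proof that 0 is a limit point of the lattice is required.\<close>
    proof (cases "at 0 within Rq q = bot")
      case False
      have lims: "((\<lambda>x. of_real (c n) * ?D k (x * q ^ n)) \<longlongrightarrow> of_real (c n) * L) (at 0 within Rq q)" for n
        using filterlim_compose[OF L filterlim_scale_at_0_within_Rq[OF q(1) Rq_power, of n]]
        by (intro tendsto_mult_left) (simp add: mult.commute)
      have "eventually (\<lambda>x. \<bar>x\<bar> \<le> 1) (at (0::real) within Rq q)"
        unfolding eventually_at by (intro exI[of _ 1]) auto
      then have "eventually (\<lambda>x. \<forall>n. cmod (of_real (c n) * ?D k (x * q ^ n)) \<le> \<bar>c n\<bar> * N) (at 0 within Rq q)"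
      proof eventually_elim
        case (elim x)
        then have "\<bar>x * q ^ n\<bar> \<le> 1" for n
          using contr[of x n] by linarith
        then show ?case using N by (auto simp: norm_mult intro!: mult_left_mono)
      qed
      then have "eventually (\<lambda>(n, x). cmod (of_real (c n) * ?D k (x * q ^ n)) \<le> \<bar>c n\<bar> * N)
          (at_top \<times>\<^sub>F (at 0 within Rq q))"
        unfolding eventually_prod_filter
        by (intro exI[of _ "\<lambda>_. True"] exI conjI) auto
      from tannerys_theorem[OF lims this summable_mult2[OF c] False]
      show ?thesis unfolding dilsum_def by blast
    qed (auto intro: tendsto_bot)
  qed
  have "dilsum q c f x = 0" if "x \<notin> Rq q" for x
    using that Eq_off[OF f] by (simp add: dilsum_def Rq_mult_power_iff[OF q(1)])
  then show ?thesis
    unfolding Eq_iff[OF q(1)] qderiv_pow_dilsum[OF q c f]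
    using bd[OF summable_abs_mult_power[OF q c]] lim[OF summable_abs_mult_power[OF q c]] by blast
qed

text \<open>Both sides sum \<open>a n * b m * u (n + m)\<close> over all pairs, by rows on the left
  and by antidiagonals on the right. Since \<open>u\<close> is bounded, the double family is
  absolutely summable and may be rearranged.\<close>

lemma Cauchy_product_shift:
  fixes a b :: "nat \<Rightarrow> real" and u :: "nat \<Rightarrow> complex"
  assumes a: "summable (\<lambda>n. \<bar>a n\<bar>)" and b: "summable (\<lambda>n. \<bar>b n\<bar>)" and u: "\<And>n. cmod (u n) \<le> M"
  shows "(\<Sum>n. of_real (a n) * (\<Sum>m. of_real (b m) * u (n + m)))
       = (\<Sum>k. of_real (\<Sum>i\<le>k. a i * b (k - i)) * u k)"
proof -
  define F where "F = (\<lambda>(n, m). of_real (a n * b m) * u (n + m))"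
  have M: "M \<ge> 0" using u[of 0] norm_ge_zero order_trans by blast
  have "(\<lambda>m. \<bar>a n\<bar> * \<bar>b m\<bar> * M) sums (\<bar>a n\<bar> * (\<Sum>m. \<bar>b m\<bar>) * M)" for n
    by (intro sums_mult sums_mult2 summable_sums b)
  then have "((\<lambda>m. \<bar>a n\<bar> * \<bar>b m\<bar> * M) has_sum (\<bar>a n\<bar> * (\<Sum>m. \<bar>b m\<bar>) * M)) UNIV" for n
    using M by (intro norm_summable_imp_has_sum) (auto intro: sums_summable)
  moreover have "(\<lambda>n. \<bar>a n\<bar> * (\<Sum>m. \<bar>b m\<bar>) * M) summable_on UNIV"
    using M suminf_nonneg[OF b]
    by (intro norm_summable_imp_summable_on) (auto simp: abs_mult intro!: summable_mult2 a)
  ultimately have "(\<lambda>(n, m). \<bar>a n\<bar> * \<bar>b m\<bar> * M) summable_on UNIV \<times> UNIV"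
    using M by (intro summable_on_SigmaI[where g = "\<lambda>n. \<bar>a n\<bar> * (\<Sum>m. \<bar>b m\<bar>) * M"]) auto
  then have "(\<lambda>x. norm (F x)) summable_on UNIV \<times> UNIV"
    by (rule Infinite_Sum.abs_summable_on_comparison_test')
      (auto simp: F_def norm_mult abs_mult intro!: mult_left_mono u)
  then obtain S where S: "(F has_sum S) (UNIV \<times> UNIV)"
    using Infinite_Sum.abs_summable_summable has_sum_infsum by blast
  have "((\<lambda>m. F (n, m)) has_sum (of_real (a n) * (\<Sum>m. of_real (b m) * u (n + m)))) UNIV" for n
  proof -
    have s: "summable (\<lambda>m. cmod (of_real (b m) * u (n + m)))"
      by (rule summable_comparison_test'[OF summable_mult2[OF b, of M]])
        (auto simp: norm_mult intro!: mult_left_mono u)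
    have "((\<lambda>m. of_real (b m) * u (n + m)) has_sum (\<Sum>m. of_real (b m) * u (n + m))) UNIV"
      by (rule norm_summable_imp_has_sum[OF s summable_sums[OF summable_norm_cancel[OF s]]])
    from has_sum_cmult_right[OF this, of "of_real (a n)"] show ?thesis
      by (simp add: F_def mult.assoc)
  qed
  from has_sum_SigmaD[OF S this]
  have 1: "(\<lambda>n. of_real (a n) * (\<Sum>m. of_real (b m) * u (n + m))) sums S"
    by (rule has_sum_imp_sums)
  \<comment> \<open>Pairs are indexed by their antidiagonal \<open>k\<close> and first entry
    \<open>i\<close>; the subtraction is exact because \<open>i \<le> k\<close>.\<close>
  have "bij_betw (\<lambda>(k, i). (i, k - i)) (SIGMA k:UNIV. {..k}) (UNIV \<times> UNIV :: (nat \<times> nat) set)"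
    by (rule bij_betw_byWitness[where f' = "\<lambda>(i, j). (i + j, i)"]) auto
  then have "((\<lambda>x. F (case x of (k, i) \<Rightarrow> (i, k - i))) has_sum S) (SIGMA k:UNIV. {..k})"
    using S by (simp add: has_sum_reindex_bij_betw)
  then have "((\<lambda>k. \<Sum>i\<le>k. F (i, k - i)) has_sum S) UNIV"
    by (rule has_sum_SigmaD) (auto intro!: has_sum_finiteI)
  then have "(\<lambda>k. \<Sum>i\<le>k. F (i, k - i)) sums S" by (rule has_sum_imp_sums)
  then have "(\<lambda>k. of_real (\<Sum>i\<le>k. a i * b (k - i)) * u k) sums S"
    by (simp add: F_def sum_distrib_right)
  with 1 show ?thesis by (simp add: sums_iff)
qed

text \<open>With \<open>u k = f (x * q ^ k)\<close> the composition has the Cauchy product as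
  coefficients, of which only the constant term 1 survives.\<close>

lemma dilsum_dilsum:
  assumes q: "0 < q" "q < 1" and a: "summable (\<lambda>n. \<bar>a n\<bar>)" and b: "summable (\<lambda>n. \<bar>b n\<bar>)"
    and f: "f \<in> Eq q" and ab: "\<And>n. (\<Sum>i\<le>n. a i * b (n - i)) = (if n = 0 then 1 else 0)"
  shows "dilsum q a (dilsum q b f) = f"
proof
  fix x
  obtain M where M: "\<And>y. \<bar>y\<bar> \<le> \<bar>x\<bar> \<Longrightarrow> cmod (f y) \<le> M"
    using Eq_bound[OF q(1) f, of "\<bar>x\<bar>" 0] by auto
  have "cmod (f (x * q ^ n)) \<le> M" for n by (rule M[OF abs_dilate_le[OF q]])
  note Cauchy_product_shift[OF a b this]
  also have "(\<Sum>k. of_real (\<Sum>i\<le>k. a i * b (k - i)) * f (x * q ^ k)) = (\<Sum>k\<in>{0}. of_real (\<Sum>i\<le>k. a i * b (k - i)) * f (x * q ^ k))"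
    by (rule suminf_finite) (auto simp: ab)
  finally show "dilsum q a (dilsum q b f) x = f x"
    using ab[of 0] by (simp add: dilsum_def power_add mult.assoc flip: of_real_mult)
qed

section \<open>Linearity and parity of dilation series\<close>

lemma dilsum_add:
  assumes "0 < q" "q < 1" "summable (\<lambda>n. \<bar>c n\<bar>)" "f \<in> Eq q" "g \<in> Eq q"
  shows "dilsum q c (\<lambda>x. f x + g x) x = dilsum q c f x + dilsum q c g x"
  using Eq_dilate_summable[OF assms(1-4), of 0 x, THEN summable_norm_cancel]
    Eq_dilate_summable[OF assms(1-3,5), of 0 x, THEN summable_norm_cancel]
  by (simp add: dilsum_def suminf_add algebra_simps)

lemma dilsum_mult:
  assumes "0 < q" "q < 1" "summable (\<lambda>n. \<bar>c n\<bar>)" "f \<in> Eq q"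
  shows "dilsum q c (\<lambda>x. k * f x) x = k * dilsum q c f x"
  using Eq_dilate_summable[OF assms, of 0 x, THEN summable_norm_cancel]
  by (simp add: dilsum_def suminf_mult[symmetric] algebra_simps)

lemma dilsum_even: "(\<And>x. f (- x) = f x) \<Longrightarrow> dilsum q c f (- x) = dilsum q c f x"
  by (simp add: dilsum_def)

lemma dilsum_odd:
  assumes "summable (\<lambda>n. of_real (c n) * f (x * q ^ n))" "\<And>x. f (- x) = - f x"
  shows "dilsum q c f (- x) = - dilsum q c f x"
  using assms by (simp add: dilsum_def suminf_minus)

text \<open>In the weight \<open>1 + t\<close> of \<open>Vop\<close>, the summand 1 keeps the even
  part and \<open>t\<close> the odd part under symmetric integration, so each parity has its own
  coefficients.\<close>

definition parity_dilsum ::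
    "real \<Rightarrow> (nat \<Rightarrow> real) \<Rightarrow> (nat \<Rightarrow> real) \<Rightarrow> (real \<Rightarrow> complex) \<Rightarrow> real \<Rightarrow> complex" where
  "parity_dilsum q a a' f x = dilsum q a (even_part f) x + dilsum q a' (odd_part f) x"

lemma even_part_Eq: "0 < q \<Longrightarrow> f \<in> Eq q \<Longrightarrow> even_part f \<in> Eq q"
  using even_part_Eq_even by (auto simp: Eq_even_def)

lemma parity_dilsum_Eq:
  assumes "0 < q" "q < 1" "summable (\<lambda>n. \<bar>a n\<bar>)" "summable (\<lambda>n. \<bar>a' n\<bar>)" "f \<in> Eq q"
  shows "parity_dilsum q a a' f \<in> Eq q"
  unfolding parity_dilsum_def[abs_def]
  by (intro Eq_add dilsum_Eq even_part_Eq odd_part_Eq assms)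

lemma parity_dilsum_linear:
  assumes "0 < q" "q < 1" "summable (\<lambda>n. \<bar>a n\<bar>)" "summable (\<lambda>n. \<bar>a' n\<bar>)" "f \<in> Eq q"
  shows "g \<in> Eq q \<Longrightarrow> parity_dilsum q a a' (f + g) = parity_dilsum q a a' f + parity_dilsum q a a' g"
    and "parity_dilsum q a a' (cscale k f) = cscale k (parity_dilsum q a a' f)"
proof -
  assume g: "g \<in> Eq q"
  have "even_part (f + g) = (\<lambda>x. even_part f x + even_part g x)"
    "odd_part (f + g) = (\<lambda>x. odd_part f x + odd_part g x)"
    by (auto simp: even_part_def odd_part_def fun_eq_iff field_simps)
  then show "parity_dilsum q a a' (f + g) = parity_dilsum q a a' f + parity_dilsum q a a' g"
    by (intro ext) (simp add: parity_dilsum_def dilsum_add even_part_Eq odd_part_Eq assms g)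
next
  have "even_part (cscale k f) = (\<lambda>x. k * even_part f x)"
    "odd_part (cscale k f) = (\<lambda>x. k * odd_part f x)"
    by (auto simp: even_part_def odd_part_def cscale_def fun_eq_iff field_simps)
  then show "parity_dilsum q a a' (cscale k f) = cscale k (parity_dilsum q a a' f)"
    by (intro ext) (simp add: parity_dilsum_def dilsum_mult even_part_Eq odd_part_Eq assms
        cscale_def algebra_simps)
qed

text \<open>A dilation series preserves parity, so the even and odd components never mix and can be
  inverted separately.\<close>

lemma parity_dilsum_inverse:
  assumes q: "0 < q" "q < 1"
    and sum: "summable (\<lambda>n. \<bar>a n\<bar>)" "summable (\<lambda>n. \<bar>a' n\<bar>)"
      "summable (\<lambda>n. \<bar>b n\<bar>)" "summable (\<lambda>n. \<bar>b' n\<bar>)"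
    and f: "f \<in> Eq q"
    and ab: "\<And>n. (\<Sum>i\<le>n. a i * b (n - i)) = (if n = 0 then 1 else 0)"
      "\<And>n. (\<Sum>i\<le>n. a' i * b' (n - i)) = (if n = 0 then 1 else 0)"
  shows "parity_dilsum q a a' (parity_dilsum q b b' f) = f"
proof -
  let ?e = "dilsum q b (even_part f)" and ?o = "dilsum q b' (odd_part f)"
  have "?e (- x) = ?e x" "?o (- x) = - ?o x" for x
    using Eq_dilate_summable[OF q sum(4) odd_part_Eq[OF q(1) f], of 0 x, THEN summable_norm_cancel]
    by (auto intro!: dilsum_even dilsum_odd simp: even_part_def odd_part_def add.commute field_simps)
  then have "even_part (parity_dilsum q b b' f) = ?e" "odd_part (parity_dilsum q b b' f) = ?o"
    by (auto simp: even_part_def[of "parity_dilsum q b b' f"] odd_part_def[of "parity_dilsum q b b' f"]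
        parity_dilsum_def fun_eq_iff)
  then have "parity_dilsum q a a' (parity_dilsum q b b' f)
      = (\<lambda>x. dilsum q a ?e x + dilsum q a' ?o x)"
    by (simp add: parity_dilsum_def[abs_def])
  also have "\<dots> = (\<lambda>x. even_part f x + odd_part f x)"
    using q sum ab even_part_Eq[OF q(1) f] odd_part_Eq[OF q(1) f] by (simp add: dilsum_dilsum)
  also have "\<dots> = f" by (auto simp: even_part_def odd_part_def fun_eq_iff field_simps)
  finally show ?thesis .
qed

section \<open>The weights and their convolution inverse\<close>

lemma qpoch_convergent:
  assumes "0 < p" "p < 1"
  shows "convergent_prod (\<lambda>k. 1 - a * p ^ k :: real)"
  using assms
  by (intro abs_convergent_prod_imp_convergent_prod summable_imp_abs_convergent_prod)
    (auto simp: abs_mult power_abs intro!: summable_mult summable_geometric)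

lemma qpoch_inf_nonzero:
  assumes "0 < p" "p < 1" "0 \<le> a" "a < 1"
  shows "qpoch_inf a p \<noteq> 0"
proof -
  have "a * p ^ k < 1" for k
    using assms mult_left_le[of "p ^ k" a] power_le_one[of p k] by linarith
  then have "1 - a * p ^ k \<noteq> 0" for k by (metis less_irrefl right_minus_eq)
  then show ?thesis
    unfolding qpoch_inf_def using assms qpoch_convergent by (intro prodinf_nonzero) auto
qed

text \<open>Splits off the factor at \<open>k = 0\<close>; \<open>a \<noteq> 1\<close> says that
  this factor is nonzero.\<close>

lemma qpoch_inf_shift:
  assumes "0 < p" "p < 1" "a \<noteq> 1"
  shows "qpoch_inf a p = (1 - a) * qpoch_inf (a * p) p"
  using prodinf_split_head[OF qpoch_convergent[OF assms(1,2), of a]] assms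
  by (simp add: qpoch_inf_def mult.assoc)

lemma qGamma_nonzero:
  assumes "0 < p" "p < 1" "0 < x"
  shows "qGamma p x \<noteq> 0"
proof -
  have "p powr x < 1" using assms powr_less_mono2[of x p 1] by simp
  then show ?thesis
    using assms qpoch_inf_nonzero[of p p] qpoch_inf_nonzero[of p "p powr x"] by (simp add: qGamma_def)
qed

lemma Cq_nonzero:
  assumes "0 < q" "q < 1" "\<alpha> > - 1 / 2"
  shows "Cq q \<alpha> \<noteq> 0"
proof -
  have "0 < q\<^sup>2" "q\<^sup>2 < 1" using assms by (auto simp: power_less_one_iff)
  then show ?thesis
    using assms qGamma_nonzero[of "q\<^sup>2" "\<alpha> + 1"] qGamma_nonzero[of "q\<^sup>2" "1/2"]
      qGamma_nonzero[of "q\<^sup>2" "\<alpha> + 1/2"] by (simp add: Cq_def)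
qed

text \<open>An even function takes the same value at the nodes \<open>q ^ n\<close> and
  \<open>- (q ^ n)\<close>, which absorbs the factor 1/2 in front of the Jackson integral.\<close>

definition rl_weight :: "real \<Rightarrow> real \<Rightarrow> nat \<Rightarrow> real" where
  "rl_weight q \<alpha> n = Cq q \<alpha> * (1 - q) * q ^ n * Wq q \<alpha> (q ^ n)"

text \<open>With \<open>p = q\<^sup>2\<close> and \<open>A = q powr (2 * \<alpha> + 1)\<close>, the
  product is the coefficient of \<open>z^n\<close> in the q-binomial series of
  \<open>(q z; p)_inf / (q A z; p)_inf\<close>. The prefactor gives the reciprocal series its
  constant term.\<close>

definition rl_inverse_weight :: "real \<Rightarrow> real \<Rightarrow> nat \<Rightarrow> real" where
  "rl_inverse_weight q \<alpha> n = inverse (rl_weight q \<alpha> 0) *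
     (\<Prod>k<n. q * (q powr (2 * \<alpha> + 1) - (q\<^sup>2) ^ k) / (1 - (q\<^sup>2) ^ Suc k))"

section \<open>Recurrences and summability of the weights\<close>

lemma powr_in_unit_interval:
  fixes q \<alpha> :: real
  assumes "0 < q" "q < 1" "\<alpha> > - 1 / 2"
  shows "0 < q powr (2 * \<alpha> + 1)" "q powr (2 * \<alpha> + 1) < 1"
  using assms powr_less_mono2[of "2 * \<alpha> + 1" q 1] by auto

lemma rl_weight_0_nonzero:
  assumes "0 < q" "q < 1" "\<alpha> > - 1 / 2"
  shows "rl_weight q \<alpha> 0 \<noteq> 0"
proof -
  have "0 < q\<^sup>2" "q\<^sup>2 < 1" using assms by (auto simp: power_less_one_iff)
  then show ?thesis
    using assms Cq_nonzero[OF assms] powr_in_unit_interval[OF assms]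
    by (simp add: rl_weight_def Wq_def qpoch_inf_nonzero)
qed

text \<open>Passing from \<open>q ^ n\<close> to \<open>q ^ Suc n\<close> removes the first factor
  from both infinite products in \<open>Wq\<close>. The cleared denominator puts the recurrence in
  the form of a functional equation for the generating function.\<close>

lemma rl_weight_Suc:
  assumes "0 < q" "q < 1" "\<alpha> > - 1 / 2"
  shows "rl_weight q \<alpha> (Suc n) * (1 - (q\<^sup>2) ^ Suc n)
       = q * (1 - q powr (2 * \<alpha> + 1) * (q\<^sup>2) ^ n) * rl_weight q \<alpha> n"
proof -
  define p where "p = q\<^sup>2"
  define A where "A = q powr (2 * \<alpha> + 1)"
  have p: "0 < p" "p < 1" using assms by (auto simp: p_def power_less_one_iff)
  have A: "0 < A" "A < 1" using powr_in_unit_interval[OF assms] by (auto simp: A_def)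
  have pn: "p ^ n \<le> 1" "p ^ Suc n < 1"
    using p by (simp_all only: power_le_one power_Suc_less_one less_imp_le)
  have "p ^ n * A \<le> 1 * A" using pn(1) A(1) by (intro mult_right_mono) auto
  then have An: "0 < p ^ n * A" "p ^ n * A < 1" using p A by (simp, linarith)
  have W: "Wq q \<alpha> (q ^ m) = qpoch_inf (p ^ m * p) p / qpoch_inf (p ^ m * A) p" for m
    by (simp add: Wq_def p_def A_def power_mult[symmetric] mult.commute)
  have N: "qpoch_inf (p ^ n * p) p = (1 - p ^ Suc n) * qpoch_inf (p ^ Suc n * p) p"
    using qpoch_inf_shift[OF p, of "p ^ n * p"] pn by (simp add: mult_ac)
  have D: "qpoch_inf (p ^ n * A) p = (1 - p ^ n * A) * qpoch_inf (p ^ Suc n * A) p"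
    using qpoch_inf_shift[OF p, of "p ^ n * A"] An by (simp add: mult_ac)
  have "qpoch_inf (p ^ n * A) p \<noteq> 0" using qpoch_inf_nonzero[OF p] An by simp
  then have "Wq q \<alpha> (q ^ Suc n) * (1 - p ^ Suc n) = (1 - A * p ^ n) * Wq q \<alpha> (q ^ n)"
    unfolding W N D using An by (auto simp: divide_simps mult_ac)
  then show ?thesis
    unfolding rl_weight_def p_def[symmetric] A_def[symmetric] by (simp add: mult_ac)
qed

lemma rl_inverse_weight_Suc:
  assumes "0 < q" "q < 1"
  shows "rl_inverse_weight q \<alpha> (Suc n) * (1 - (q\<^sup>2) ^ Suc n)
       = q * (q powr (2 * \<alpha> + 1) - (q\<^sup>2) ^ n) * rl_inverse_weight q \<alpha> n"
proof -
  have "q\<^sup>2 < 1" using assms by (auto simp: power_less_one_iff)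
  then have "(q\<^sup>2) ^ Suc n < 1" using assms by (intro power_Suc_less_one) auto
  then show ?thesis by (simp add: rl_inverse_weight_def)
qed

text \<open>Ratio test: since \<open>p ^ Suc n\<close> tends to 0, the quotients of successive terms
  tend to \<open>\<rho>\<close>. It is applied with limit \<open>q\<close> for the weights and
  \<open>q * A\<close> for the inverse weights.\<close>

lemma summable_abs_of_recurrence:
  fixes s r :: "nat \<Rightarrow> real"
  assumes p: "0 < p" "p < 1" and rec: "\<And>n. s (Suc n) * (1 - p ^ Suc n) = r n * s n"
    and r: "r \<longlonglongrightarrow> \<rho>" and \<rho>: "\<bar>\<rho>\<bar> < 1"
  shows "summable (\<lambda>n. \<bar>s n\<bar>)"
proof -
  have "(\<lambda>n. p ^ Suc n) \<longlonglongrightarrow> 0" using p by (intro LIMSEQ_Suc LIMSEQ_realpow_zero) auto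
  then have "(\<lambda>n. \<bar>r n / (1 - p ^ Suc n)\<bar>) \<longlonglongrightarrow> \<bar>\<rho> / (1 - 0)\<bar>" by (intro tendsto_intros r) auto
  moreover obtain c where c: "\<bar>\<rho>\<bar> < c" "c < 1" using \<rho> dense by blast
  ultimately have "eventually (\<lambda>n. \<bar>r n / (1 - p ^ Suc n)\<bar> < c) sequentially"
    by (simp add: order_tendstoD(2))
  then obtain N where N: "\<And>n. n \<ge> N \<Longrightarrow> \<bar>r n / (1 - p ^ Suc n)\<bar> < c"
    unfolding eventually_sequentially by blast
  show ?thesis
  proof (rule summable_ratio_test[OF c(2)])
    fix n assume "N \<le> n"
    have "p ^ Suc n < 1" using p by (intro power_Suc_less_one) auto
    then have "s (Suc n) = r n / (1 - p ^ Suc n) * s n" using rec[of n] by (simp add: field_simps)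
    then have "\<bar>s (Suc n)\<bar> = \<bar>r n / (1 - p ^ Suc n)\<bar> * \<bar>s n\<bar>" by (simp add: abs_mult)
    also have "\<dots> \<le> c * \<bar>s n\<bar>" using N[OF \<open>N \<le> n\<close>] by (intro mult_right_mono) auto
    finally show "norm \<bar>s (Suc n)\<bar> \<le> c * norm \<bar>s n\<bar>" by simp
  qed
qed

lemma rl_weights_summable:
  assumes q: "0 < q" "q < 1" "\<alpha> > - 1 / 2"
  shows "summable (\<lambda>n. \<bar>rl_weight q \<alpha> n\<bar>)" "summable (\<lambda>n. \<bar>rl_inverse_weight q \<alpha> n\<bar>)"
proof -
  define A where "A = q powr (2 * \<alpha> + 1)"
  have A: "0 < A" "A < 1" using powr_in_unit_interval[OF q] by (auto simp: A_def)
  have p: "0 < q\<^sup>2" "q\<^sup>2 < 1" using q by (auto simp: power_less_one_iff)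
  have lim: "(\<lambda>n. (q\<^sup>2) ^ n) \<longlonglongrightarrow> 0" using p by (intro LIMSEQ_realpow_zero) auto
  have "(\<lambda>n. q * (1 - A * (q\<^sup>2) ^ n)) \<longlonglongrightarrow> q * (1 - A * 0)" by (intro tendsto_intros lim)
  then show "summable (\<lambda>n. \<bar>rl_weight q \<alpha> n\<bar>)"
    by (rule summable_abs_of_recurrence[OF p rl_weight_Suc[OF q, folded A_def]]) (use q in auto)
  have "q * A < 1" using q A mult_strict_mono[of q 1 A 1] by simp
  then have "\<bar>q * (A - 0)\<bar> < 1" using q A by (simp add: abs_mult)
  moreover have "(\<lambda>n. q * (A - (q\<^sup>2) ^ n)) \<longlonglongrightarrow> q * (A - 0)" by (intro tendsto_intros lim)
  ultimately show "summable (\<lambda>n. \<bar>rl_inverse_weight q \<alpha> n\<bar>)"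
    by (intro summable_abs_of_recurrence[OF p rl_inverse_weight_Suc[OF q(1,2), of \<alpha>, folded A_def]])
qed

text \<open>The recurrences are functional equations \<open>(1 - q z) F(z) = (1 - q A z) F(p z)\<close> and
  \<open>(1 - q A z) G(z) = (1 - q z) G(p z)\<close> of the generating functions, so \<open>F G\<close> is invariant under
  \<open>z \<mapsto> p z\<close>, hence constant.\<close>

lemma convolution_of_dual_recurrences:
  fixes a b :: "nat \<Rightarrow> real"
  assumes p: "0 < p" "p < 1"
    and a: "\<And>n. a (Suc n) * (1 - p ^ Suc n) = q * (1 - A * p ^ n) * a n"
    and b: "\<And>n. b (Suc n) * (1 - p ^ Suc n) = q * (A - p ^ n) * b n"
  shows "(\<Sum>i\<le>n. a i * b (n - i)) = (if n = 0 then a 0 * b 0 else 0)"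
proof -
  define F G where "F = Abs_fps a" and "G = Abs_fps b"
  \<comment> \<open>These are the series \<open>F(p z)\<close> and \<open>G(p z)\<close>, while
    \<open>X\<close> below stands for \<open>q z\<close>.\<close>
  define F' G' where "F' = Abs_fps (\<lambda>n. p ^ n * a n)" and "G' = Abs_fps (\<lambda>n. p ^ n * b n)"
  define X :: "real fps" where "X = fps_const q * fps_X"
  have nth_X: "fps_nth (X * H) n = (if n = 0 then 0 else q * fps_nth H (n - 1))" for H n
    by (simp add: X_def mult.assoc fps_X_mult_nth)
  have X0 [simp]: "fps_nth X 0 = 0" by (simp add: X_def)
  have nth_1X: "fps_nth ((1 - fps_const C * X) * H) n = fps_nth H n - (if n = 0 then 0 else C * q * fps_nth H (n - 1))"
    for C H n by (simp add: left_diff_distrib mult.assoc nth_X)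
  \<comment> \<open>The factor \<open>fps_const 1\<close> is kept so that \<open>nth_1X\<close>
    applies to both linear factors.\<close>
  have F: "(1 - fps_const 1 * X) * F = (1 - fps_const A * X) * F'"
  proof (rule fps_ext)
    fix n
    show "fps_nth ((1 - fps_const 1 * X) * F) n = fps_nth ((1 - fps_const A * X) * F') n"
    proof (cases n)
      case (Suc m)
      show ?thesis using a[of m] unfolding nth_1X by (simp add: Suc F_def F'_def right_diff_distrib left_diff_distrib mult_ac)
    qed (simp add: nth_1X F_def F'_def)
  qed
  have G: "(1 - fps_const A * X) * G = (1 - fps_const 1 * X) * G'"
  proof (rule fps_ext)
    fix n
    show "fps_nth ((1 - fps_const A * X) * G) n = fps_nth ((1 - fps_const 1 * X) * G') n"
    proof (cases n)
      case (Suc m)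
      show ?thesis using b[of m] unfolding nth_1X by (simp add: Suc G_def G'_def right_diff_distrib left_diff_distrib mult_ac)
    qed (simp add: nth_1X G_def G'_def)
  qed
  let ?U = "(1 - fps_const 1 * X) * (1 - fps_const A * X)"
  have "fps_nth (1 - fps_const 1 * X) 0 \<noteq> 0" "fps_nth (1 - fps_const A * X) 0 \<noteq> 0" by simp_all
  \<comment> \<open>Both linear factors have constant term 1, and formal power series over the reals
    form an integral domain, so \<open>?U\<close> can be cancelled below.\<close>
  then have "?U \<noteq> 0" by (metis fps_zero_nth mult_eq_0_iff)
  moreover have "?U * (F * G) = ?U * (F' * G')"
    using F G by (metis (no_types, lifting) mult.assoc mult.left_commute)
  ultimately have "F * G = F' * G'" by simp
  moreover have "fps_nth (F' * G') n = p ^ n * fps_nth (F * G) n"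
  proof -
    have "p ^ i * a i * (p ^ (n - i) * b (n - i)) = p ^ n * (a i * b (n - i))" if "i \<le> n" for i
      using that power_add[of p i "n - i"] by simp
    then show ?thesis
      by (auto simp: fps_mult_nth F_def G_def F'_def G'_def sum_distrib_left intro!: sum.cong)
  qed
  \<comment> \<open>Invariance under \<open>z -> p z\<close> multiplies the \<open>n\<close>-th
    coefficient by \<open>p ^ n\<close> without changing it, so it is 0 unless
    \<open>n = 0\<close>.\<close>
  ultimately have "fps_nth (F * G) n * (1 - p ^ n) = 0" by (simp add: algebra_simps)
  moreover have "n > 0 \<Longrightarrow> p ^ n < 1" using p by (simp add: power_less_one_iff)
  ultimately have "n > 0 \<Longrightarrow> fps_nth (F * G) n = 0" by auto
  moreover have "fps_nth (F * G) n = (\<Sum>i\<le>n. a i * b (n - i))"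
    by (simp add: fps_mult_nth F_def G_def atMost_atLeast0)
  ultimately show ?thesis by auto
qed

lemma rl_weight_convolution:
  assumes q: "0 < q" "q < 1" "\<alpha> > - 1 / 2"
  shows "(\<Sum>i\<le>n. rl_weight q \<alpha> i * rl_inverse_weight q \<alpha> (n - i)) = (if n = 0 then 1 else 0)"
proof -
  have p: "0 < q\<^sup>2" "q\<^sup>2 < 1" using q by (auto simp: power_less_one_iff)
  have "rl_weight q \<alpha> 0 * rl_inverse_weight q \<alpha> 0 = 1"
    using rl_weight_0_nonzero[OF q] by (simp add: rl_inverse_weight_def)
  then show ?thesis
    using convolution_of_dual_recurrences[OF p rl_weight_Suc[OF q] rl_inverse_weight_Suc[OF q(1,2)]]
    by simp
qed

lemma convolution_commute:
  fixes a b :: "nat \<Rightarrow> real"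
  shows "(\<Sum>i\<le>n. a i * b (n - i)) = (\<Sum>i\<le>n. b i * a (n - i))"
  by (rule sum.reindex_bij_witness[of _ "\<lambda>i. n - i" "\<lambda>i. n - i"]) auto

text \<open>Replacing \<open>z\<close> by \<open>q z\<close> in both generating functions does the
  same to their product; hence the odd-part coefficients are convolution inverses along with the
  even-part ones.\<close>

lemma convolution_mult_power:
  fixes a b :: "nat \<Rightarrow> real"
  shows "(\<Sum>i\<le>n. a i * q ^ i * (b (n - i) * q ^ (n - i))) = q ^ n * (\<Sum>i\<le>n. a i * b (n - i))"
proof -
  have "a i * q ^ i * (b (n - i) * q ^ (n - i)) = q ^ n * (a i * b (n - i))" if "i \<le> n" for i
    using that power_add[of q i "n - i"] by simp
  then show ?thesis unfolding sum_distrib_left by (intro sum.cong) auto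
qed

section \<open>The operators as series of dilations\<close>

lemma Wq_minus [simp]: "Wq q \<alpha> (- t) = Wq q \<alpha> t"
  by (simp add: Wq_def)

lemma Rop_eq_dilsum:
  assumes q: "0 < q" "q < 1" "\<alpha> > - 1 / 2" and f: "f \<in> Eq_even q"
  shows "Rop q \<alpha> f = dilsum q (rl_weight q \<alpha>) f"
proof
  fix x
  let ?W = "\<lambda>n. of_real (Wq q \<alpha> (q ^ n)) :: complex"
  have ev: "f (- y) = f y" and fE: "f \<in> Eq q" for y using f by (auto simp: Eq_even_def)
  \<comment> \<open>Pulling a constant out of \<open>suminf\<close> asks for summability of the
    series without it, which follows from that of the scaled series because the constant is
    nonzero.\<close>
  have nz: "of_real (Cq q \<alpha> * (1 - q)) \<noteq> (0 :: complex)" using Cq_nonzero[OF q] q(2) by simp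
  have s: "summable (\<lambda>n. of_real (rl_weight q \<alpha> n) * f (x * q ^ n))"
    using Eq_dilate_summable[OF q(1,2) rl_weights_summable(1)[OF q] fE, of 0 x]
    by (simp add: summable_norm_cancel)
  have e: "of_real (rl_weight q \<alpha> n) * f (x * q ^ n)
     = of_real (Cq q \<alpha> * (1 - q)) / 2 * (of_real (q ^ n) * (?W n * f (x * q ^ n) + of_real (Wq q \<alpha> (- (q ^ n))) * f (x * - (q ^ n))))" for n
    by (simp add: rl_weight_def ev)
  have "(\<Sum>n. of_real (rl_weight q \<alpha> n) * f (x * q ^ n))
      = of_real (Cq q \<alpha> * (1 - q)) / 2 * (\<Sum>n. of_real (q ^ n) * (?W n * f (x * q ^ n) + of_real (Wq q \<alpha> (- (q ^ n))) * f (x * - (q ^ n))))"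
    using s nz unfolding e by (intro suminf_mult) (simp only: summable_cmult_iff, simp)
  then show "Rop q \<alpha> f x = dilsum q (rl_weight q \<alpha>) f x"
    by (simp add: Rop_def jackson_sym_def dilsum_def)
qed

text \<open>For \<open>t = q ^ n\<close>, the nodes \<open>t\<close> and \<open>-t\<close> together
  contribute \<open>(1 + t) f(x t) + (1 - t) f(-x t)\<close>, which is twice
  \<open>f_e(x t) + t f_o(x t)\<close>.\<close>

lemma Vop_eq_parity_dilsum:
  assumes q: "0 < q" "q < 1" "\<alpha> > - 1 / 2" and f: "f \<in> Eq q"
  shows "Vop q \<alpha> f = parity_dilsum q (rl_weight q \<alpha>) (\<lambda>n. rl_weight q \<alpha> n * q ^ n) f"
proof
  fix x
  let ?T = "\<lambda>t. of_real (Wq q \<alpha> t * (1 + t)) * f (x * t)"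
  let ?a = "rl_weight q \<alpha>"
  have nz: "of_real (Cq q \<alpha> * (1 - q)) \<noteq> (0 :: complex)" using Cq_nonzero[OF q] q(2) by simp
  have s1: "summable (\<lambda>n. of_real (?a n) * even_part f (x * q ^ n))"
    using Eq_dilate_summable[OF q(1,2) rl_weights_summable(1)[OF q] even_part_Eq[OF q(1) f], of 0 x]
    by (simp add: summable_norm_cancel)
  have s2: "summable (\<lambda>n. of_real (?a n * q ^ n) * odd_part f (x * q ^ n))"
    using Eq_dilate_summable[OF q(1,2) summable_abs_mult_power[OF q(1,2) rl_weights_summable(1)[OF q], of 1]
        odd_part_Eq[OF q(1) f], of 0 x]
    by (simp add: summable_norm_cancel)
  have e: "of_real (?a n) * even_part f (x * q ^ n) + of_real (?a n * q ^ n) * odd_part f (x * q ^ n)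
     = of_real (Cq q \<alpha> * (1 - q)) / 2 * (of_real (q ^ n) * (?T (q ^ n) + ?T (- (q ^ n))))" for n
    by (simp add: rl_weight_def even_part_def odd_part_def field_simps)
  have "parity_dilsum q ?a (\<lambda>n. ?a n * q ^ n) f x
     = (\<Sum>n. of_real (Cq q \<alpha> * (1 - q)) / 2 * (of_real (q ^ n) * (?T (q ^ n) + ?T (- (q ^ n)))))"
    unfolding parity_dilsum_def dilsum_def suminf_add[OF s1 s2] e ..
  also have "\<dots> = of_real (Cq q \<alpha> * (1 - q)) / 2 * (\<Sum>n. of_real (q ^ n) * (?T (q ^ n) + ?T (- (q ^ n))))"
    using summable_add[OF s1 s2] nz unfolding e
    by (intro suminf_mult) (simp only: summable_cmult_iff, simp)
  finally show "Vop q \<alpha> f x = parity_dilsum q ?a (\<lambda>n. ?a n * q ^ n) f x"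
    by (simp add: Vop_def jackson_sym_def)
qed

section \<open>The Jackson integral as an antiderivative\<close>

lemma Iq_eq_dilsum:
  "Iq q f x = of_real ((1 - q) * \<bar>q * x\<bar>) * dilsum q (\<lambda>n. q ^ n) f \<bar>q * x\<bar>"
  by (simp add: Iq_def jackson_def dilsum_def)

text \<open>For an even function \<open>F\<close> the q-derivative reduces to
  \<open>(F(z/q) - F(z)) / ((1 - q) z)\<close>. With \<open>F = Iq q f\<close> the two integrals end
  at \<bar>z\<bar> and \<bar>q z\<bar>, so they differ by the first Jackson term
  \<open>(1 - q) |z| f(|z|)\<close>, and oddness removes the absolute values.\<close>

lemma qderiv_Iq:
  assumes q: "0 < q" "q < 1" and f: "f \<in> Eq q" and odd: "\<And>x. f (- x) = - f x"
  shows "qderiv q (Iq q f) = f"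
proof
  fix z
  show "qderiv q (Iq q f) z = f z"
  proof (cases "z = 0")
    \<comment> \<open>Here \<open>0\<close> is off the lattice, so \<open>f 0 = 0\<close>, which
      agrees with the division by zero in \<open>qderiv\<close>.\<close>
    case True
    then show ?thesis using Eq_off[OF f, of 0] Rq_nonzero[OF q(1), of 0] by (auto simp: qderiv_def)
  next
    case False
    have "summable (\<lambda>n. \<bar>q ^ n\<bar>)" using q by (simp add: power_abs summable_geometric)
    then have s: "summable (\<lambda>n. of_real (q ^ n) * f (\<bar>z\<bar> * q ^ n))"
      using Eq_dilate_summable[OF q _ f, of "\<lambda>n. q ^ n" 0 "\<bar>z\<bar>"] by (simp add: summable_norm_cancel)
    then have "summable (\<lambda>n. of_real (q ^ Suc n) * f (\<bar>z\<bar> * q ^ Suc n))"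
      by (subst summable_Suc_iff)
    then have "summable (\<lambda>n. of_real q * (of_real (q ^ n) * f (\<bar>q * z\<bar> * q ^ n)))"
      using q by (simp add: abs_mult mult_ac)
    then have s': "summable (\<lambda>n. of_real (q ^ n) * f (\<bar>q * z\<bar> * q ^ n))"
      using q by (simp only: summable_cmult_iff) simp
    \<comment> \<open>Splitting off the node at \<open>n = 0\<close> leaves \<open>q\<close> times
      the same series at \<bar>q z\<bar>; this is the difference of the two integrals.\<close>
    have "dilsum q (\<lambda>n. q ^ n) f \<bar>z\<bar> = f \<bar>z\<bar> + (\<Sum>n. of_real (q ^ Suc n) * f (\<bar>z\<bar> * q ^ Suc n))"
      unfolding dilsum_def suminf_split_head[OF s] by simp
    also have "(\<Sum>n. of_real (q ^ Suc n) * f (\<bar>z\<bar> * q ^ Suc n))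
        = (\<Sum>n. of_real q * (of_real (q ^ n) * f (\<bar>q * z\<bar> * q ^ n)))"
      using q by (simp add: abs_mult mult_ac)
    also have "\<dots> = of_real q * dilsum q (\<lambda>n. q ^ n) f \<bar>q * z\<bar>"
      unfolding dilsum_def by (rule suminf_mult[OF s'])
    finally have d: "dilsum q (\<lambda>n. q ^ n) f \<bar>z\<bar> = f \<bar>z\<bar> + of_real q * dilsum q (\<lambda>n. q ^ n) f \<bar>q * z\<bar>" .
    have even: "Iq q f (- y) = Iq q f y" for y by (simp add: Iq_def)
    have "q * (inverse q * z) = z" using q by simp
    then have "Iq q f (inverse q * z) = of_real ((1 - q) * \<bar>z\<bar>) * dilsum q (\<lambda>n. q ^ n) f \<bar>z\<bar>"
      by (simp only: Iq_eq_dilsum)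
    also have "\<dots> = of_real ((1 - q) * \<bar>z\<bar>) * f \<bar>z\<bar> + Iq q f z"
      unfolding d Iq_eq_dilsum using q by (simp add: abs_mult algebra_simps)
    finally have "qderiv q (Iq q f) z
        = 2 * (of_real ((1 - q) * \<bar>z\<bar>) * f \<bar>z\<bar>) / of_real (2 * (1 - q) * z)"
      unfolding qderiv_def even by simp
    also have "of_real ((1 - q) * \<bar>z\<bar>) * f \<bar>z\<bar> = of_real ((1 - q) * z) * f z"
      using odd[of z] by (simp add: abs_if)
    also have "2 * (of_real ((1 - q) * z) * f z) / of_real (2 * (1 - q) * z) = f z"
    proof -
      have "of_real ((1 - q) * z) \<noteq> (0 :: complex)" using q False by (simp only: of_real_eq_0_iff) simp
      moreover have "of_real (2 * (1 - q) * z) = (2 * of_real ((1 - q) * z) :: complex)" by simp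
      ultimately show ?thesis by (simp only: divide_eq_eq mult_eq_0_iff) simp
    qed
    finally show ?thesis .
  qed
qed

text \<open>The first q-derivative is \<open>f\<close>, so every order above 0 is inherited from
  \<open>f\<close>. For order 0 the estimate by \<open>M * \<bar>x\<bar>\<close> yields both local
  boundedness and the limit 0.\<close>

lemma Iq_Eq_even:
  assumes q: "0 < q" "q < 1" and f: "f \<in> Eq q" and odd: "\<And>x. f (- x) = - f x"
  shows "Iq q f \<in> Eq_even q"
proof -
  have s: "summable (\<lambda>n. \<bar>q ^ n\<bar>)" using q by (simp add: power_abs summable_geometric)
  have g: "dilsum q (\<lambda>n. q ^ n) f \<in> Eq q" (is "?g \<in> _") by (rule dilsum_Eq[OF q s f])
  have bd: "\<exists>M\<ge>0. \<forall>x. \<bar>x\<bar> \<le> a \<longrightarrow> cmod (Iq q f x) \<le> M * \<bar>x\<bar>" for a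
  proof -
    obtain M where M: "M \<ge> 0" "\<And>x. \<bar>x\<bar> \<le> a \<Longrightarrow> cmod (?g x) \<le> M"
      using Eq_bound[OF q(1) g, of a 0] by auto
    have "cmod (Iq q f x) \<le> M * \<bar>x\<bar>" if "\<bar>x\<bar> \<le> a" for x
    proof -
      have qx: "\<bar>q * x\<bar> \<le> \<bar>x\<bar>" using q mult_left_le_one_le[of "\<bar>x\<bar>" q] by (simp add: abs_mult)
      have "cmod (Iq q f x) = (1 - q) * \<bar>q * x\<bar> * cmod (?g \<bar>q * x\<bar>)"
        unfolding Iq_eq_dilsum norm_mult norm_of_real using q by (simp add: abs_mult)
      also have "\<dots> \<le> 1 * \<bar>x\<bar> * M"
        using q qx that by (intro mult_mono M) auto
      finally show ?thesis by (simp add: mult.commute)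
    qed
    with M(1) show ?thesis by blast
  qed
  have "Iq q f x = 0" if "x \<notin> Rq q" for x
  proof -
    have "\<bar>q * x\<bar> \<notin> Rq q" using that Rq_q_mult_iff(1)[OF q(1), of x] by (auto simp: abs_if simp del: mult_minus_right)
    then have "?g \<bar>q * x\<bar> = 0" by (rule Eq_off[OF g])
    then show ?thesis by (simp add: Iq_eq_dilsum)
  qed
  moreover have "\<exists>M. \<forall>x. \<bar>x\<bar> \<le> a \<longrightarrow> cmod ((qderiv q ^^ k) (Iq q f) x) \<le> M" for k a
  proof (cases k)
    case 0
    obtain M where M: "M \<ge> 0" "\<And>x. \<bar>x\<bar> \<le> a \<Longrightarrow> cmod (Iq q f x) \<le> M * \<bar>x\<bar>" using bd by blast
    then have "\<bar>x\<bar> \<le> a \<Longrightarrow> cmod (Iq q f x) \<le> M * a" for x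
      by (meson mult_left_mono order_trans)
    with 0 show ?thesis by auto
  next
    case (Suc j)
    obtain M where "\<And>x. \<bar>x\<bar> \<le> a \<Longrightarrow> cmod ((qderiv q ^^ j) f x) \<le> M"
      using Eq_bound[OF q(1) f] by metis
    then show ?thesis
      by (auto simp: Suc funpow_Suc_right qderiv_Iq[OF q f odd] simp del: funpow.simps)
  qed
  moreover have "\<exists>L. ((qderiv q ^^ k) (Iq q f) \<longlongrightarrow> L) (at 0 within Rq q)" for k
  proof (cases k)
    case 0
    obtain M where M: "\<And>x. \<bar>x\<bar> \<le> 1 \<Longrightarrow> cmod (Iq q f x) \<le> M * \<bar>x\<bar>" using bd by blast
    have ev: "eventually (\<lambda>x. cmod (Iq q f x) \<le> M * \<bar>x\<bar>) (at 0 within Rq q)"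
      unfolding eventually_at by (intro exI[of _ 1]) (auto intro!: M)
    have "((\<lambda>x. M * \<bar>x\<bar>) \<longlongrightarrow> M * \<bar>0\<bar>) (at 0 within Rq q)" by (intro tendsto_intros)
    then have "((\<lambda>x. M * \<bar>x\<bar>) \<longlongrightarrow> 0) (at 0 within Rq q)" by simp
    from Lim_null_comparison[OF ev this] show ?thesis unfolding 0 funpow_0 ..
  next
    case (Suc j)
    obtain L where "((qderiv q ^^ j) f \<longlongrightarrow> L) (at 0 within Rq q)"
      using Eq_tendsto[OF f] by blast
    moreover have "(qderiv q ^^ k) (Iq q f) = (qderiv q ^^ j) f"
      by (simp add: Suc funpow_Suc_right qderiv_Iq[OF q f odd] del: funpow.simps)
    ultimately show ?thesis by auto
  qed
  moreover have "Iq q f (- x) = Iq q f x" for x by (simp add: Iq_def)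
  ultimately show ?thesis by (simp add: Eq_even_def Eq_iff[OF q(1)])
qed

text \<open>The two coefficient sequences are convolution inverses, and convolution commutes. One
  order of composition shows that \<open>Rop\<close> is injective on \<open>Eq_even q\<close>, the
  other that the series is a preimage of \<open>f\<close>.\<close>

lemma inv_into_Rop:
  assumes q: "0 < q" "q < 1" "\<alpha> > - 1 / 2" and f: "f \<in> Eq_even q"
  shows "inv_into (Eq_even q) (Rop q \<alpha>) f = dilsum q (rl_inverse_weight q \<alpha>) f"
proof (rule inv_into_f_eq)
  note s = rl_weights_summable[OF q]
  note conv = rl_weight_convolution[OF q]
  have closed: "dilsum q c g \<in> Eq_even q" if "summable (\<lambda>n. \<bar>c n\<bar>)" "g \<in> Eq_even q" for c g
    using that by (auto simp: Eq_even_def intro: dilsum_Eq[OF q(1,2)] dilsum_even)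
  show "inj_on (Rop q \<alpha>) (Eq_even q)"
  proof (rule inj_on_inverseI)
    fix g assume "g \<in> Eq_even q"
    then show "dilsum q (rl_inverse_weight q \<alpha>) (Rop q \<alpha> g) = g"
      using Rop_eq_dilsum[OF q] conv
      by (simp add: Eq_even_def dilsum_dilsum[OF q(1,2) s(2,1)] convolution_commute[of "rl_inverse_weight q \<alpha>"])
  qed
  show "dilsum q (rl_inverse_weight q \<alpha>) f \<in> Eq_even q" by (rule closed[OF s(2) f])
  then show "Rop q \<alpha> (dilsum q (rl_inverse_weight q \<alpha>) f) = f"
    using Rop_eq_dilsum[OF q] conv f by (simp add: Eq_even_def dilsum_dilsum[OF q(1,2) s])
qed

theorem theorem7:
  fixes q \<alpha> :: real
  assumes "0 < q" and "q < 1"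
    and "\<exists>m::int. ln (1 - q) / ln q = 2 * of_int m"
    and "\<alpha> > - 1 / 2"
  shows "linear_iso_on (Eq q) (Eq q) (Vop q \<alpha>) \<and>
    (\<forall>f \<in> Eq q. \<forall>x \<in> Rq q.
       inv_into (Eq q) (Vop q \<alpha>) f x =
         inv_into (Eq_even q) (Rop q \<alpha>) (even_part f) x
         + qderiv q (inv_into (Eq_even q) (Rop q \<alpha>) (Iq q (odd_part f))) x)"
proof -
  note q = assms(1,2,4)
  define a b where "a = rl_weight q \<alpha>" and "b = rl_inverse_weight q \<alpha>"
  \<comment> \<open>The coefficients acting on odd parts, for \<open>Vop\<close> and for its
    inverse.\<close>
  define a' b' where "a' = (\<lambda>n. a n * q ^ n)" and "b' = (\<lambda>n. b n * q ^ n)"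
  have s: "summable (\<lambda>n. \<bar>a n\<bar>)" "summable (\<lambda>n. \<bar>b n\<bar>)"
    unfolding a_def b_def by (rule rl_weights_summable[OF q])+
  have s': "summable (\<lambda>n. \<bar>a' n\<bar>)" "summable (\<lambda>n. \<bar>b' n\<bar>)"
    unfolding a'_def b'_def using summable_abs_mult_power[OF q(1,2) s(1), of 1]
      summable_abs_mult_power[OF q(1,2) s(2), of 1] by simp_all
  have ab: "(\<Sum>i\<le>n. a i * b (n - i)) = (if n = 0 then 1 else 0)" for n
    unfolding a_def b_def by (rule rl_weight_convolution[OF q])
  then have ab': "(\<Sum>i\<le>n. a' i * b' (n - i)) = (if n = 0 then 1 else 0)" for n
    unfolding a'_def b'_def convolution_mult_power by simp
  have ba: "(\<Sum>i\<le>n. b i * a (n - i)) = (if n = 0 then 1 else 0)"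
    and ba': "(\<Sum>i\<le>n. b' i * a' (n - i)) = (if n = 0 then 1 else 0)" for n
    using ab ab' by (simp_all add: convolution_commute[of b] convolution_commute[of b'])
  have V: "Vop q \<alpha> f = parity_dilsum q a a' f" if "f \<in> Eq q" for f
    using Vop_eq_parity_dilsum[OF q that] by (simp add: a_def a'_def)
  have closed: "parity_dilsum q a a' f \<in> Eq q" "parity_dilsum q b b' f \<in> Eq q" if "f \<in> Eq q" for f
    using that q s s' by (auto intro: parity_dilsum_Eq)
  have VW: "Vop q \<alpha> (parity_dilsum q b b' f) = f" if "f \<in> Eq q" for f
    using V[OF closed(2)[OF that]] parity_dilsum_inverse[OF q(1,2) s(1) s'(1) s(2) s'(2) that ab ab']
    by simp
  have WV: "parity_dilsum q b b' (Vop q \<alpha> f) = f" if "f \<in> Eq q" for f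
    using V[OF that] parity_dilsum_inverse[OF q(1,2) s(2) s'(2) s(1) s'(1) that ba ba'] by simp
  \<comment> \<open>\<open>VW\<close> and \<open>WV\<close> make \<open>parity_dilsum q b b'\<close>
    a two-sided inverse on \<open>Eq q\<close>, which gives bijectivity and the value of
    \<open>inv_into\<close> together.\<close>
  have bij: "bij_betw (Vop q \<alpha>) (Eq q) (Eq q)"
    by (rule bij_betw_byWitness[where f' = "parity_dilsum q b b'"])
      (use VW WV V closed in auto)
  have sub: "cfun.subspace (Eq q)" by (rule subspace_Eq[OF q(1)])
  have "linear_iso_on (Eq q) (Eq q) (Vop q \<alpha>)"
    unfolding linear_iso_on_def
    using sub bij V cfun.subspace_add[OF sub] cfun.subspace_scale[OF sub]
      parity_dilsum_linear[OF q(1,2) s(1) s'(1)] by simp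
  moreover have "inv_into (Eq q) (Vop q \<alpha>) f x =
         inv_into (Eq_even q) (Rop q \<alpha>) (even_part f) x
         + qderiv q (inv_into (Eq_even q) (Rop q \<alpha>) (Iq q (odd_part f))) x"
    if f: "f \<in> Eq q" for f x
  proof -
    have o: "odd_part f \<in> Eq q" "odd_part f (- y) = - odd_part f y" for y
      using odd_part_Eq[OF q(1) f] by (auto simp: odd_part_def field_simps)
    have I: "Iq q (odd_part f) \<in> Eq_even q" by (rule Iq_Eq_even[OF q(1,2) o])
    then have IE: "Iq q (odd_part f) \<in> Eq q" by (simp add: Eq_even_def)
    have "inv_into (Eq q) (Vop q \<alpha>) f = parity_dilsum q b b' f"
      using inv_into_f_eq[OF bij_betw_imp_inj_on[OF bij], OF closed(2)[OF f], OF VW[OF f]] .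
    moreover have "inv_into (Eq_even q) (Rop q \<alpha>) (even_part f) = dilsum q b (even_part f)"
      unfolding b_def by (rule inv_into_Rop[OF q even_part_Eq_even[OF q(1) f]])
    \<comment> \<open>The inverse of \<open>Rop\<close> is the series with coefficients
      \<open>b\<close>. One q-derivative turns \<open>b n\<close> into \<open>b n * q ^ n\<close>
      and \<open>Iq q (odd_part f)\<close> into \<open>odd_part f\<close>.\<close>
    moreover have "qderiv q (inv_into (Eq_even q) (Rop q \<alpha>) (Iq q (odd_part f))) = dilsum q b' (odd_part f)"
      using qderiv_pow_dilsum[OF q(1,2) s(2) IE, of 1]
      by (simp add: inv_into_Rop[OF q I] qderiv_Iq[OF q(1,2) o] b_def b'_def)
    ultimately show ?thesis by (simp add: parity_dilsum_def)
  qed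
  ultimately show ?thesis by blast
qed

end
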